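(* Let $(X,\mathcal F)$ be a compact Polish foliated space, and let $X_0\subset X$ be the union of the leaves without holonomy. Consider the equivalence relation on $X$ given by: $x\sim y$ if and only if the leaf $L_x$ has the same growth type as the leaf $L_y$. The relation set $\{(x,y)\mid x\sim y\}$ restricted to $X_0\times X_0$ is a Borel subset of $X_0\times X_0$, and the relation set in $X\times X$ is a Baire subset of $X\times X$. In particular, the equivalence classes of the restriction of $\sim$ to $X_0$ are Borel in $X_0$, and the equivalence classes of $\sim$ in $X$ are Baire subsets of $X$.
   Context: Foliated spaces. A (topological) foliated structure $\mathcal F$ of dimension $n$ on a space $X$ is given by an atlas $\{(U_i,\phi_i)\}$, where $\{U_i\}$ is an open cover of $X$ and $\phi_i:U_i\to B_i\times Z_i$ are homeomorphisms, with $B_i\subset\mathbb R^n$ an open ball and $Z_i$ a locally compact Polish space, whose changes of coordinates are locally of the form $\phi_j\phi_i^{-1}(x,z)=(x_{ij}(x,z),h_{ij}(z))$. The sets $\phi_i^{-1}(B_i\times\{z\})$ are the plaques; the leaves are the connected components of $X$ with the (leaf) topology whose basic open sets are the plaques of all foliated charts. $L_x$ is the leaf through $x$. $(X,\mathcal F)$ is a compact Polish foliated space if $X$ is compact, Hausdorff and second countable. Regular atlas and holonomy. A foliated atlas $\mathcal U=\{(U_i,\phi_i)\}$ is regular if: each $(U_i,\phi_i)$ is the restriction of a foliated chart $(\widetilde U_i,\tilde\phi_i)$ with $\overline{U_i}\subset\widetilde U_i$; $\{U_i\}$ is locally finite; and the closure of every plaque of $(U_i,\phi_i)$ meets at most the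 closure of one plaque of $(U_j,\phi_j)$, for all $i,j$. Let $p_i:U_i\to Z_i$ be $\phi_i$ followed by the second projection; there are homeomorphisms $h_{ij}:p_i(U_i\cap U_j)\to p_j(U_i\cap U_j)$ with $p_j=h_{ij}p_i$ on $U_i\cap U_j$, generating the holonomy pseudogroup $\mathcal H$ on $\bigsqcup_iZ_i$. The holonomy group of the leaf through $x\in U_i$ is the group of germs at $p_i(x)$ of maps in $\mathcal H$ fixing $p_i(x)$; a leaf is without holonomy if this group is trivial. Leaf metrics and growth. Fix a regular foliated atlas $\mathcal U$. For $x,y$ in the same leaf, $d^*_{\mathcal U}(x,y)=0$ if $x=y$, and otherwise it is the minimum number of $\mathcal U$-plaques whose union is connected and contains $x$ and $y$. For $x\in X$ and $r>0$, $v_{\mathcal U}(x,r)$ is the number of $\mathcal U$-plaques that meet the ball of center $x$ and radius $r$ in $(L_x,d^*_{\mathcal U})$. For non-decreasing functions $u,v:\mathbb R^+\to\mathbb R^+$, $u$ is dominated by $v$ if there are $a,b\ge1$ and $c>0$ with $u(r)\le a\,v(br)$ for all $r\ge c$; $u$ and $v$ have the same growth type if each is dominated by the other. The growth type of a leaf $L$ is the growth type of $r\mapsto v_{\mathcal U}(x,r)$ for any $x\in L$; it is independent of $x$ and $\mathcal U$. Baire subsets. A subset of a topological space is meager if it is a countable union of nowhere dense sets, and Baire (has the Baire property) if its symmetric difference with some open set is meager. *)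

theory Defs
  imports "HOL-Analysis.Analysis"
begin

section \<open>Foliated charts and foliated structures\<close>

text \<open>
  A chart is a homeomorphism from an open set \<^term>\<open>fdom c\<close> of the ambient space onto
  \<^term>\<open>fball c \<times> topspace (ftrans c)\<close>.  \<^term>\<open>Euclidean_space n\<close> realises
  $\mathbb R^n$ on the sequences vanishing from index \<open>n\<close> on, so the dimension is an
  arbitrary natural number.  The transversals of the charts may be arbitrary different
  spaces; they only share a carrier type.
\<close>

record ('a, 'z) fchart =
  fdom :: "'a set"
  fmap :: "'a \<Rightarrow> (nat \<Rightarrow> real) \<times> 'z"
  fball :: "(nat \<Rightarrow> real) set"
  ftrans :: "'z topology"

definition euclidean_open_ball :: "nat \<Rightarrow> (nat \<Rightarrow> real) \<Rightarrow> real \<Rightarrow> (nat \<Rightarrow> real) set" where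
  "euclidean_open_ball n a r =
     {x \<in> topspace (Euclidean_space n). L2_set (\<lambda>i. x i - a i) {..<n} < r}"

definition is_fchart :: "nat \<Rightarrow> 'a topology \<Rightarrow> ('a, 'z) fchart \<Rightarrow> bool" where
  "is_fchart n X c \<longleftrightarrow>
     openin X (fdom c) \<and>
     (\<exists>a \<in> topspace (Euclidean_space n). \<exists>r>0. fball c = euclidean_open_ball n a r) \<and>
     completely_metrizable_space (ftrans c) \<and> second_countable (ftrans c) \<and>
     locally_compact_space (ftrans c) \<and>
     homeomorphic_map (subtopology X (fdom c))
       (prod_topology (subtopology (Euclidean_space n) (fball c)) (ftrans c)) (fmap c)"

definition plaques :: "('a, 'z) fchart \<Rightarrow> 'a set set" where
  "plaques c = {{x \<in> fdom c. snd (fmap c x) = z} | z. z \<in> topspace (ftrans c)}"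

text \<open>
  The change of coordinates from \<open>c\<close> to \<open>d\<close> is locally of the form
  $(u,z) \mapsto (g(u,z), h(z))$.  Continuity of \<open>g\<close> and \<open>h\<close> is automatic, since
  \<open>fmap c\<close> and \<open>fmap d\<close> are homeomorphisms and the second projection is open.
\<close>

definition fcompatible :: "'a topology \<Rightarrow> ('a, 'z) fchart \<Rightarrow> ('a, 'z) fchart \<Rightarrow> bool" where
  "fcompatible X c d \<longleftrightarrow>
     (\<forall>p \<in> fdom c \<inter> fdom d. \<exists>N. openin X N \<and> p \<in> N \<and> N \<subseteq> fdom c \<inter> fdom d \<and>
        (\<exists>g h. \<forall>q\<in>N. fmap d q = (g (fmap c q), h (snd (fmap c q)))))"

definition foliated_atlas :: "nat \<Rightarrow> 'a topology \<Rightarrow> ('a, 'z) fchart set \<Rightarrow> bool" where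
  "foliated_atlas n X A \<longleftrightarrow>
     (\<forall>c\<in>A. is_fchart n X c) \<and> (\<Union>c\<in>A. fdom c) = topspace X \<and>
     (\<forall>c\<in>A. \<forall>d\<in>A. fcompatible X c d)"

text \<open>The charts of the maximal atlas determined by the atlas \<open>A\<close>.\<close>

definition foliated_chart ::
    "nat \<Rightarrow> 'a topology \<Rightarrow> ('a, 'z) fchart set \<Rightarrow> ('a, 'z) fchart \<Rightarrow> bool" where
  "foliated_chart n X A c \<longleftrightarrow>
     is_fchart n X c \<and> (\<forall>d\<in>A. fcompatible X c d \<and> fcompatible X d c)"

definition compact_polish_foliated_space ::
    "nat \<Rightarrow> 'a topology \<Rightarrow> ('a, 'z) fchart set \<Rightarrow> bool" where
  "compact_polish_foliated_space n X A \<longleftrightarrow>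
     compact_space X \<and> Hausdorff_space X \<and> second_countable X \<and> foliated_atlas n X A"

definition leaf_topology :: "nat \<Rightarrow> 'a topology \<Rightarrow> ('a, 'z) fchart set \<Rightarrow> 'a topology" where
  "leaf_topology n X A = topology_generated_by (\<Union>c\<in>{c. foliated_chart n X A c}. plaques c)"

definition leaves :: "nat \<Rightarrow> 'a topology \<Rightarrow> ('a, 'z) fchart set \<Rightarrow> 'a set set" where
  "leaves n X A = connected_components_of (leaf_topology n X A)"

definition leaf :: "nat \<Rightarrow> 'a topology \<Rightarrow> ('a, 'z) fchart set \<Rightarrow> 'a \<Rightarrow> 'a set" where
  "leaf n X A x = connected_component_of_set (leaf_topology n X A) x"

section \<open>Regular atlases\<close>

definition fchart_restriction :: "('a, 'z) fchart \<Rightarrow> ('a, 'z) fchart \<Rightarrow> bool" where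
  "fchart_restriction c c' \<longleftrightarrow>
     fdom c \<subseteq> fdom c' \<and> (\<forall>x\<in>fdom c. fmap c x = fmap c' x) \<and> fball c \<subseteq> fball c' \<and>
     (\<exists>S \<subseteq> topspace (ftrans c'). ftrans c = subtopology (ftrans c') S)"

text \<open>A regular foliated atlas \<open>U\<close> of the foliated structure defined by \<open>A\<close>.\<close>

definition regular_foliated_atlas ::
    "nat \<Rightarrow> 'a topology \<Rightarrow> ('a, 'z) fchart set \<Rightarrow> ('a, 'z) fchart set \<Rightarrow> bool" where
  "regular_foliated_atlas n X A U \<longleftrightarrow>
     foliated_atlas n X U \<and> (\<forall>c\<in>U. foliated_chart n X A c) \<and>
     (\<forall>c\<in>U. \<exists>c'. foliated_chart n X A c' \<and> fchart_restriction c c' \<and>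
        X closure_of (fdom c) \<subseteq> fdom c') \<and>
     (\<forall>x\<in>topspace X. \<exists>N. openin X N \<and> x \<in> N \<and> finite {c\<in>U. fdom c \<inter> N \<noteq> {}}) \<and>
     (\<forall>c\<in>U. \<forall>d\<in>U. \<forall>P\<in>plaques c. \<forall>Q\<in>plaques d. \<forall>Q'\<in>plaques d.
        X closure_of P \<inter> X closure_of Q \<noteq> {} \<and> X closure_of P \<inter> X closure_of Q' \<noteq> {}
          \<longrightarrow> Q = Q')"

section \<open>Holonomy\<close>

text \<open>
  A partial homeomorphism of a space is encoded as a pair \<open>(D, f)\<close> with \<open>D\<close> its open
  domain; the values of \<open>f\<close> outside \<open>D\<close> are irrelevant.
\<close>

definition partial_homeo :: "'p topology \<Rightarrow> 'p set \<Rightarrow> ('p \<Rightarrow> 'p) \<Rightarrow> bool" where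
  "partial_homeo T D f \<longleftrightarrow> openin T D \<and> openin T (f ` D) \<and>
     homeomorphic_map (subtopology T D) (subtopology T (f ` D)) f"

text \<open>
  The last clause is the gluing axiom; taking \<open>E = D\<close> there, it also makes membership
  independent of the values of a map outside its domain.
\<close>

definition pseudogroup :: "'p topology \<Rightarrow> ('p set \<times> ('p \<Rightarrow> 'p)) set \<Rightarrow> bool" where
  "pseudogroup T H \<longleftrightarrow>
     (\<forall>(D, f) \<in> H. partial_homeo T D f) \<and>
     (topspace T, id) \<in> H \<and>
     (\<forall>(D, f) \<in> H. (f ` D, inv_into D f) \<in> H) \<and>
     (\<forall>(D, f) \<in> H. \<forall>(E, g) \<in> H. ({x \<in> D. f x \<in> E}, g \<circ> f) \<in> H) \<and>
     (\<forall>(D, f) \<in> H. \<forall>E. openin T E \<and> E \<subseteq> D \<longrightarrow> (E, f) \<in> H) \<and>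
     (\<forall>D f. partial_homeo T D f \<and>
        (\<forall>x\<in>D. \<exists>(E, g) \<in> H. x \<in> E \<and> E \<subseteq> D \<and> (\<forall>y\<in>E. f y = g y)) \<longrightarrow> (D, f) \<in> H)"

definition pseudogroup_generated ::
    "'p topology \<Rightarrow> ('p set \<times> ('p \<Rightarrow> 'p)) set \<Rightarrow> ('p set \<times> ('p \<Rightarrow> 'p)) set" where
  "pseudogroup_generated T G = \<Inter>{H. pseudogroup T H \<and> G \<subseteq> H}"

text \<open>The disjoint union of the transversals; a point \<open>z\<close> of the transversal of \<open>c\<close> is \<open>(c, z)\<close>.\<close>

definition total_transversal :: "('a, 'z) fchart set \<Rightarrow> (('a, 'z) fchart \<times> 'z) topology" where
  "total_transversal U = sum_topology ftrans U"

definition ftransversal_point :: "('a, 'z) fchart \<Rightarrow> 'a \<Rightarrow> ('a, 'z) fchart \<times> 'z" where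
  "ftransversal_point c x = (c, snd (fmap c x))"

text \<open>The elementary holonomy maps $h_{cd}$, characterised by $p_d = h_{cd}\,p_c$ on the overlap.\<close>

definition elementary_holonomy ::
    "('a, 'z) fchart set \<Rightarrow>
     ((('a, 'z) fchart \<times> 'z) set \<times> (('a, 'z) fchart \<times> 'z \<Rightarrow> ('a, 'z) fchart \<times> 'z)) set" where
  "elementary_holonomy U =
     {(D, h). \<exists>c\<in>U. \<exists>d\<in>U. D = ftransversal_point c ` (fdom c \<inter> fdom d) \<and>
        (\<forall>x \<in> fdom c \<inter> fdom d. h (ftransversal_point c x) = ftransversal_point d x)}"

definition holonomy_pseudogroup ::
    "('a, 'z) fchart set \<Rightarrow>
     ((('a, 'z) fchart \<times> 'z) set \<times> (('a, 'z) fchart \<times> 'z \<Rightarrow> ('a, 'z) fchart \<times> 'z)) set" where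
  "holonomy_pseudogroup U =
     pseudogroup_generated (total_transversal U) (elementary_holonomy U)"

definition germ_at :: "'p topology \<Rightarrow> 'p \<Rightarrow> ('p \<Rightarrow> 'p) \<Rightarrow> ('p \<Rightarrow> 'p) set" where
  "germ_at T p f = {g. \<exists>N. openin T N \<and> p \<in> N \<and> (\<forall>q\<in>N. g q = f q)}"

text \<open>
  The underlying set of the holonomy group at \<open>p\<close>; its group operation is composition of germs,
  with the germ of the identity as neutral element.
\<close>

definition holonomy_group ::
    "('a, 'z) fchart set \<Rightarrow> ('a, 'z) fchart \<times> 'z \<Rightarrow>
     (('a, 'z) fchart \<times> 'z \<Rightarrow> ('a, 'z) fchart \<times> 'z) set set" where
  "holonomy_group U p =
     {germ_at (total_transversal U) p f | D f.
        (D, f) \<in> holonomy_pseudogroup U \<and> p \<in> D \<and> f p = p}"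

definition without_holonomy :: "('a, 'z) fchart set \<Rightarrow> 'a set \<Rightarrow> bool" where
  "without_holonomy U L \<longleftrightarrow>
     (\<forall>x\<in>L. \<forall>c\<in>U. x \<in> fdom c \<longrightarrow>
        holonomy_group U (ftransversal_point c x) =
          {germ_at (total_transversal U) (ftransversal_point c x) id})"

definition leaves_without_holonomy_union ::
    "nat \<Rightarrow> 'a topology \<Rightarrow> ('a, 'z) fchart set \<Rightarrow> ('a, 'z) fchart set \<Rightarrow> 'a set" where
  "leaves_without_holonomy_union n X A U = \<Union>{L \<in> leaves n X A. without_holonomy U L}"

section \<open>Growth of leaves\<close>

definition atlas_plaques :: "('a, 'z) fchart set \<Rightarrow> 'a set set" where
  "atlas_plaques U = (\<Union>c\<in>U. plaques c)"

text \<open>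
  Only meaningful for two points of the same leaf.  Connectedness of a union of plaques refers
  to the leaf topology.
\<close>

definition plaque_dist ::
    "nat \<Rightarrow> 'a topology \<Rightarrow> ('a, 'z) fchart set \<Rightarrow> ('a, 'z) fchart set \<Rightarrow> 'a \<Rightarrow> 'a \<Rightarrow> nat" where
  "plaque_dist n X A U x y =
     (if x = y then 0
      else LEAST k. \<exists>\<P>. \<P> \<subseteq> atlas_plaques U \<and> finite \<P> \<and> card \<P> = k \<and>
        connectedin (leaf_topology n X A) (\<Union>\<P>) \<and> x \<in> \<Union>\<P> \<and> y \<in> \<Union>\<P>)"

definition leaf_ball ::
    "nat \<Rightarrow> 'a topology \<Rightarrow> ('a, 'z) fchart set \<Rightarrow> ('a, 'z) fchart set \<Rightarrow> 'a \<Rightarrow> real \<Rightarrow> 'a set" where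
  "leaf_ball n X A U x r = {y \<in> leaf n X A x. real (plaque_dist n X A U x y) < r}"

text \<open>
  For a regular atlas of a compact space only finitely many plaques meet a ball, so the
  cardinality below is the true one.
\<close>

definition leaf_growth ::
    "nat \<Rightarrow> 'a topology \<Rightarrow> ('a, 'z) fchart set \<Rightarrow> ('a, 'z) fchart set \<Rightarrow> 'a \<Rightarrow> real \<Rightarrow> real" where
  "leaf_growth n X A U x r =
     real (card {P \<in> atlas_plaques U. P \<inter> leaf_ball n X A U x r \<noteq> {}})"

definition growth_dominated :: "(real \<Rightarrow> real) \<Rightarrow> (real \<Rightarrow> real) \<Rightarrow> bool" where
  "growth_dominated u v \<longleftrightarrow>
     (\<exists>a\<ge>1. \<exists>b\<ge>1. \<exists>c>0. \<forall>r\<ge>c. u r \<le> a * v (b * r))"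

definition same_growth_type :: "(real \<Rightarrow> real) \<Rightarrow> (real \<Rightarrow> real) \<Rightarrow> bool" where
  "same_growth_type u v \<longleftrightarrow> growth_dominated u v \<and> growth_dominated v u"

definition growth_relation ::
    "nat \<Rightarrow> 'a topology \<Rightarrow> ('a, 'z) fchart set \<Rightarrow> ('a, 'z) fchart set \<Rightarrow> ('a \<times> 'a) set" where
  "growth_relation n X A U =
     {(x, y) \<in> topspace X \<times> topspace X.
        same_growth_type (leaf_growth n X A U x) (leaf_growth n X A U y)}"

section \<open>Borel and Baire subsets of a topological space\<close>

definition borel_subset :: "'p topology \<Rightarrow> 'p set \<Rightarrow> bool" where
  "borel_subset T S \<longleftrightarrow> S \<in> sigma_sets (topspace T) {V. openin T V}"

definition nowhere_dense_in :: "'p topology \<Rightarrow> 'p set \<Rightarrow> bool" where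
  "nowhere_dense_in T S \<longleftrightarrow> S \<subseteq> topspace T \<and> T interior_of (T closure_of S) = {}"

definition meager_in :: "'p topology \<Rightarrow> 'p set \<Rightarrow> bool" where
  "meager_in T S \<longleftrightarrow> (\<exists>\<N>. countable \<N> \<and> (\<forall>N\<in>\<N>. nowhere_dense_in T N) \<and> S = \<Union>\<N>)"

definition baire_subset :: "'p topology \<Rightarrow> 'p set \<Rightarrow> bool" where
  "baire_subset T S \<longleftrightarrow>
     S \<subseteq> topspace T \<and> (\<exists>V. openin T V \<and> meager_in T (sym_diff S V))"

end

theory Submission
  imports Defs
begin

text \<open>
  The growth relation turns out to be Borel on all of \<open>X \<times> X\<close>.  Saturating an open set by the relation ``lying on a common plaque'' gives an open set, because the
  transversal projections of the charts are continuous and open.  Hence, for each \<open>m\<close>, if the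
  ball of radius \<open>m\<close> around \<open>x\<close> meets \<open>k\<close> distinct plaques, separating their transversal
  coordinates by disjoint open sets shows that the balls around nearby points meet \<open>k\<close> distinct
  plaques as well: the number of plaques meeting the ball is lower semicontinuous in \<open>x\<close>.  Domination
  of monotone functions can be tested on natural numbers with natural constants, so the growth relation
  is a countable combination of Borel sets, and Borel sets have the Baire property.
\<close>

section \<open>Charts and the leaf topology\<close>

lemma L2_set_scale: "L2_set (\<lambda>i. t * f i) S = \<bar>t\<bar> * L2_set f S" for t :: real
  by (simp add: L2_set_def power_mult_distrib sum_distrib_left[symmetric] real_sqrt_mult)

text \<open>The ball is star-shaped: it is the union of the segments from its center
  \<open>a\<close>, all of which contain \<open>a\<close>. A segment stays in
  \<open>Euclidean_space n\<close> because both endpoints vanish from index \<open>n\<close>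
  on.\<close>

lemma connectedin_euclidean_open_ball:
  assumes a: "a \<in> topspace (Euclidean_space n)" and r: "r > 0"
  shows "connectedin (Euclidean_space n) (euclidean_open_ball n a r)"
proof -
  define B where "B = euclidean_open_ball n a r"
  define seg where "seg x = (\<lambda>t::real. \<lambda>i. a i + t * (x i - a i)) ` {0..1}" for x
  have aB: "a \<in> B"
    using a r by (simp add: B_def euclidean_open_ball_def L2_set_def)
  have seg: "connectedin (Euclidean_space n) (seg x) \<and> a \<in> seg x \<and> x \<in> seg x \<and> seg x \<subseteq> B"
    if x: "x \<in> B" for x
  proof (intro conjI)
    have zero: "x i = 0" "a i = 0" if "i \<ge> n" for i
      using x a that by (auto simp: B_def euclidean_open_ball_def topspace_Euclidean_space)
    have "continuous_map euclideanreal (Euclidean_space n) (\<lambda>t i. a i + t * (x i - a i))"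
      unfolding Euclidean_space_def continuous_map_in_subtopology continuous_map_componentwise_UNIV
      using zero by (auto intro!: continuous_intros)
    moreover have "connectedin euclideanreal {0..1}"
      by simp
    ultimately show "connectedin (Euclidean_space n) (seg x)"
      unfolding seg_def by (rule connectedin_continuous_map_image)
    show "a \<in> seg x"
      unfolding seg_def by (rule image_eqI[of _ _ 0]) auto
    show "x \<in> seg x"
      unfolding seg_def by (rule image_eqI[of _ _ 1]) auto
    have len: "L2_set (\<lambda>i. x i - a i) {..<n} < r"
      using x by (simp add: B_def euclidean_open_ball_def)
    have "L2_set (\<lambda>i. t * (x i - a i)) {..<n} < r" if t: "0 \<le> t" "t \<le> 1" for t
    proof -
      have "t * L2_set (\<lambda>i. x i - a i) {..<n} \<le> 1 * L2_set (\<lambda>i. x i - a i) {..<n}"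
        using t by (intro mult_right_mono) (auto simp: L2_set_nonneg)
      with len t show ?thesis by (simp add: L2_set_scale)
    qed
    then show "seg x \<subseteq> B"
      using zero by (auto simp: seg_def B_def euclidean_open_ball_def topspace_Euclidean_space)
  qed
  have "B = \<Union>(seg ` B)" using seg by blast
  moreover have "connectedin (Euclidean_space n) (\<Union>(seg ` B))"
    using seg aB by (intro connectedin_Union) auto
  ultimately show ?thesis by (simp add: B_def)
qed

context
  fixes n :: nat and X :: "'a topology" and c :: "('a, 'z) fchart"
  assumes chart: "is_fchart n X c"
begin

lemma openin_fdom: "openin X (fdom c)"
  using chart by (simp add: is_fchart_def)

lemma fdom_subset: "fdom c \<subseteq> topspace X"
  using openin_fdom by (rule openin_subset)

lemma Hausdorff_ftrans: "Hausdorff_space (ftrans c)"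
  using chart by (simp add: is_fchart_def completely_metrizable_imp_metrizable_space
      metrizable_imp_Hausdorff_space)

lemma homeomorphic_map_fmap:
  "homeomorphic_map (subtopology X (fdom c))
     (prod_topology (subtopology (Euclidean_space n) (fball c)) (ftrans c)) (fmap c)"
  using chart by (simp add: is_fchart_def)

lemma continuous_map_transversal:
  "continuous_map (subtopology X (fdom c)) (ftrans c) (\<lambda>x. snd (fmap c x))"
  using continuous_map_compose[OF homeomorphic_imp_continuous_map[OF homeomorphic_map_fmap]
      continuous_map_snd] by (simp add: o_def)

lemma open_map_transversal:
  "open_map (subtopology X (fdom c)) (ftrans c) (\<lambda>x. snd (fmap c x))"
  using open_map_compose[OF homeomorphic_imp_open_map[OF homeomorphic_map_fmap]
      open_map_snd] by (simp add: o_def)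

lemma transversal_in_ftrans: "x \<in> fdom c \<Longrightarrow> snd (fmap c x) \<in> topspace (ftrans c)"
  using continuous_map_image_subset_topspace[OF continuous_map_transversal] fdom_subset by auto

lemma openin_transversal_vimage:
  assumes "openin (ftrans c) V"
  shows "openin X {x \<in> fdom c. snd (fmap c x) \<in> V}"
proof -
  have "openin (subtopology X (fdom c)) {x \<in> topspace (subtopology X (fdom c)). snd (fmap c x) \<in> V}"
    by (rule openin_continuous_map_preimage[OF continuous_map_transversal assms])
  then show ?thesis
    using fdom_subset by (simp add: openin_open_subtopology openin_fdom inf.absorb2)
qed

lemma connectedin_fball: "connectedin (Euclidean_space n) (fball c)"
  using chart connectedin_euclidean_open_ball by (auto simp: is_fchart_def)

lemma fball_nonempty: "fball c \<noteq> {}"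
  using chart by (auto simp: is_fchart_def euclidean_open_ball_def L2_set_def)

text \<open>Slicing the inverse of the chart at the height \<open>z\<close> presents the plaque as a
  continuous image of a connected ball. Continuity is for the topology of \<open>X\<close> here; the
  leaf topology is reached later.\<close>

lemma plaque_parametrization:
  assumes z: "z \<in> topspace (ftrans c)"
  obtains g where "continuous_map (subtopology (Euclidean_space n) (fball c)) X g"
    and "g ` fball c = {x \<in> fdom c. snd (fmap c x) = z}"
proof -
  let ?E = "subtopology (Euclidean_space n) (fball c)"
  have top: "topspace ?E = fball c"
    using connectedin_subset_topspace[OF connectedin_fball] by auto
  obtain g where g: "homeomorphic_maps (subtopology X (fdom c)) (prod_topology ?E (ftrans c)) (fmap c) g"
    using homeomorphic_map_fmap homeomorphic_map_maps by blast
  then have cg: "continuous_map (prod_topology ?E (ftrans c)) (subtopology X (fdom c)) g"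
    and cf: "continuous_map (subtopology X (fdom c)) (prod_topology ?E (ftrans c)) (fmap c)"
    and gf: "\<And>x. x \<in> fdom c \<Longrightarrow> g (fmap c x) = x"
    and fg: "\<And>u w. u \<in> fball c \<Longrightarrow> w \<in> topspace (ftrans c) \<Longrightarrow> fmap c (g (u, w)) = (u, w)"
    using fdom_subset top by (auto simp: homeomorphic_maps_def)
  have "continuous_map ?E (prod_topology ?E (ftrans c)) (\<lambda>u. (u, z))"
    using z by (intro continuous_map_pairedI) auto
  from continuous_map_compose[OF this cg]
  have c: "continuous_map ?E (subtopology X (fdom c)) (\<lambda>u. g (u, z))"
    by (simp add: o_def)
  then have "g (u, z) \<in> fdom c" if "u \<in> fball c" for u
    using continuous_map_image_subset_topspace[OF c] that top by auto
  moreover have "x \<in> (\<lambda>u. g (u, z)) ` fball c" if x: "x \<in> fdom c" "snd (fmap c x) = z" for x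
  proof (rule image_eqI)
    show "x = g (fst (fmap c x), z)"
      using gf[OF x(1)] x(2) by (metis prod.collapse)
    show "fst (fmap c x) \<in> fball c"
      using continuous_map_image_subset_topspace[OF cf] x fdom_subset top by fastforce
  qed
  ultimately have "(\<lambda>u. g (u, z)) ` fball c = {x \<in> fdom c. snd (fmap c x) = z}"
    using fg z by auto
  with c show thesis
    by (intro that[of "\<lambda>u. g (u, z)"]) (auto simp: continuous_map_in_subtopology)
qed

lemma plaque_nonempty:
  assumes "z \<in> topspace (ftrans c)"
  obtains x where "x \<in> fdom c" "snd (fmap c x) = z"
  using plaque_parametrization[OF assms] fball_nonempty by blast

end

lemma fcompatibleE:
  assumes "fcompatible X c d" "p \<in> fdom c" "p \<in> fdom d"
  obtains N g h where "openin X N" "p \<in> N" "N \<subseteq> fdom c \<inter> fdom d"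
    "\<forall>q\<in>N. fmap d q = (g (fmap c q), h (snd (fmap c q)))"
proof -
  have "\<exists>N. openin X N \<and> p \<in> N \<and> N \<subseteq> fdom c \<inter> fdom d \<and>
      (\<exists>g h. \<forall>q\<in>N. fmap d q = (g (fmap c q), h (snd (fmap c q))))"
    by (rule bspec[OF assms(1)[unfolded fcompatible_def]]) (simp add: assms)
  then show thesis
  proof (elim exE conjE)
    fix N g h
    assume "openin X N" "p \<in> N" "N \<subseteq> fdom c \<inter> fdom d"
      "\<forall>q\<in>N. fmap d q = (g (fmap c q), h (snd (fmap c q)))"
    then show thesis by (rule that[of N g h])
  qed
qed

text \<open>The composition through a chart of \<open>A\<close> is needed because two charts of the maximal atlas
  are only required to be compatible with \<open>A\<close>.\<close>

lemma foliated_charts_transversal_local: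
  assumes A: "foliated_atlas n X A" and c: "foliated_chart n X A c" and d: "foliated_chart n X A d"
    and p: "p \<in> fdom c" "p \<in> fdom d"
  obtains N where "openin X N" "p \<in> N" "N \<subseteq> fdom c \<inter> fdom d"
    "\<And>q. q \<in> N \<Longrightarrow> snd (fmap c q) = snd (fmap c p) \<Longrightarrow> snd (fmap d q) = snd (fmap d p)"
proof -
  have "p \<in> topspace X"
    using c p(1) fdom_subset[of n X c] by (auto simp: foliated_chart_def)
  then obtain a where a: "a \<in> A" "p \<in> fdom a"
    using A unfolding foliated_atlas_def by blast
  have "fcompatible X c a" "fcompatible X a d"
    using c d a(1) by (simp_all add: foliated_chart_def)
  from fcompatibleE[OF this(1) p(1) a(2)] obtain N g h where
    N: "openin X N" "p \<in> N" "N \<subseteq> fdom c \<inter> fdom a"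
      "\<forall>q\<in>N. fmap a q = (g (fmap c q), h (snd (fmap c q)))" .
  from fcompatibleE[OF \<open>fcompatible X a d\<close> a(2) p(2)] obtain N' g' h' where
    N': "openin X N'" "p \<in> N'" "N' \<subseteq> fdom a \<inter> fdom d"
      "\<forall>q\<in>N'. fmap d q = (g' (fmap a q), h' (snd (fmap a q)))" .
  show thesis
    by (rule that[of "N \<inter> N'"]) (use N N' in auto)
qed

text \<open>The plaques generate the leaf topology, so continuity of the parametrization
  \<open>g\<close> is tested on preimages of plaques \<open>Q\<close> of other charts
  \<open>d\<close>. Near a point of both plaques, constancy of the coordinate of \<open>c\<close>
  along \<open>P\<close> forces constancy of that of \<open>d\<close>, so nearby points of
  \<open>P\<close> stay in \<open>Q\<close>.\<close>

lemma connectedin_leaf_topology_plaque: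
  assumes A: "foliated_atlas n X A" and c: "foliated_chart n X A c" and P: "P \<in> plaques c"
  shows "connectedin (leaf_topology n X A) P"
proof -
  have chart: "is_fchart n X c" using c by (simp add: foliated_chart_def)
  obtain z where z: "z \<in> topspace (ftrans c)" and P_eq: "P = {x \<in> fdom c. snd (fmap c x) = z}"
    using P by (auto simp: plaques_def)
  let ?E = "subtopology (Euclidean_space n) (fball c)"
  obtain g where g: "continuous_map ?E X g" "g ` fball c = P"
    using plaque_parametrization[OF chart z] P_eq by metis
  have top: "topspace ?E = fball c"
    using connectedin_subset_topspace[OF connectedin_fball[OF chart]] by auto
  have "continuous_map ?E (leaf_topology n X A) g"
    unfolding leaf_topology_def
  proof (rule continuous_on_generated_topo)
    fix Q assume "Q \<in> (\<Union>c\<in>{c. foliated_chart n X A c}. plaques c)"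
    then obtain d w where d: "foliated_chart n X A d" and Q: "Q = {x \<in> fdom d. snd (fmap d x) = w}"
      by (auto simp: plaques_def)
    have "\<exists>T. openin ?E T \<and> u \<in> T \<and> T \<subseteq> g -` Q \<inter> topspace ?E" if u: "u \<in> g -` Q \<inter> topspace ?E" for u
    proof -
      have gu: "g u \<in> fdom c" "snd (fmap c (g u)) = z" "g u \<in> fdom d" "snd (fmap d (g u)) = w"
        using u g(2) top Q P_eq by auto
      then obtain N where N: "openin X N" "g u \<in> N" "N \<subseteq> fdom c \<inter> fdom d"
        "\<And>q. q \<in> N \<Longrightarrow> snd (fmap c q) = z \<Longrightarrow> snd (fmap d q) = w"
        using foliated_charts_transversal_local[OF A c d, of "g u"] by metis
      have "openin ?E {v \<in> topspace ?E. g v \<in> N}"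
        by (rule openin_continuous_map_preimage[OF g(1) N(1)])
      moreover have "{v \<in> topspace ?E. g v \<in> N} \<subseteq> g -` Q \<inter> topspace ?E"
        using N g(2) top Q P_eq by blast
      ultimately show ?thesis
        using u N(2) by (intro exI[of _ "{v \<in> topspace ?E. g v \<in> N}"]) auto
    qed
    then show "openin ?E (g -` Q \<inter> topspace ?E)"
      using openin_subopen by blast
  next
    show "g ` topspace ?E \<subseteq> \<Union> (\<Union>c\<in>{c. foliated_chart n X A c}. plaques c)"
      using g(2) top c P by auto
  qed
  moreover have "connectedin ?E (fball c)"
    using connectedin_fball[OF chart] by simp
  ultimately show ?thesis
    using connectedin_continuous_map_image g(2) by blast
qed

section \<open>Balls of the plaque metric\<close>

text \<open>The ball of radius \<open>r\<close> with \<open>m < r \<le> m + 1\<close>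
  around \<open>x\<close> for the plaque distance is the image of \<open>x\<close> under the \<open>m\<close>-th iterate.\<close>

definition plaque_rel :: "('a, 'z) fchart set \<Rightarrow> 'a rel" where
  "plaque_rel U = {(x, y). \<exists>c\<in>U. x \<in> fdom c \<and> y \<in> fdom c \<and> snd (fmap c x) = snd (fmap c y)}"

text \<open>Plaques meeting the ball, recorded as a chart and a transversal coordinate.  A set that is a
  plaque of several charts is thus counted several times; this changes the growth only by a bounded
  factor and makes the count lower semicontinuous.\<close>

definition ball_labels :: "('a, 'z) fchart set \<Rightarrow> 'a \<Rightarrow> nat \<Rightarrow> (('a, 'z) fchart \<times> 'z) set" where
  "ball_labels U x m =
     {ftransversal_point c y | c y. c \<in> U \<and> y \<in> fdom c \<and> (x, y) \<in> plaque_rel U ^^ m}"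

definition label_plaque :: "('a, 'z) fchart \<times> 'z \<Rightarrow> 'a set" where
  "label_plaque l = {x \<in> fdom (fst l). snd (fmap (fst l) x) = snd l}"

lemma sym_plaque_rel: "sym (plaque_rel U)"
  by (auto simp: sym_def plaque_rel_def)

lemma sym_relpow: "sym r \<Longrightarrow> sym (r ^^ m)"
proof (induction m)
  case (Suc m)
  then have "converse (r ^^ m O r) = r ^^ m O r"
    by (simp add: converse_relcomp sym_conv_converse_eq relpow_commute)
  then show ?case by (simp add: sym_conv_converse_eq)
qed (simp add: sym_def)

lemma plaque_relI: "P \<in> atlas_plaques U \<Longrightarrow> x \<in> P \<Longrightarrow> y \<in> P \<Longrightarrow> (x, y) \<in> plaque_rel U"
  by (auto simp: atlas_plaques_def plaques_def plaque_rel_def)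

lemma Hausdorff_finite_separation:
  assumes T: "Hausdorff_space T" and S: "finite S" "S \<subseteq> topspace T"
  obtains V where "\<And>s. s \<in> S \<Longrightarrow> openin T (V s) \<and> s \<in> V s" "disjoint_family_on V S"
proof -
  have "\<forall>p. \<exists>q. fst p \<in> S \<and> snd p \<in> S \<and> fst p \<noteq> snd p \<longrightarrow>
      openin T (fst q) \<and> openin T (snd q) \<and> fst p \<in> fst q \<and> snd p \<in> snd q \<and> disjnt (fst q) (snd q)"
    using T S(2) by (auto simp: Hausdorff_space_def) (meson subsetD)
  then obtain q where q: "\<And>s t. s \<in> S \<Longrightarrow> t \<in> S \<Longrightarrow> s \<noteq> t \<Longrightarrow>
      openin T (fst (q (s, t))) \<and> openin T (snd (q (s, t))) \<and> s \<in> fst (q (s, t)) \<and> t \<in> snd (q (s, t)) \<and>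
      disjnt (fst (q (s, t))) (snd (q (s, t)))"
    unfolding choice_iff by (metis fst_conv snd_conv)
  \<comment> \<open>The choice \<open>q\<close> need not be symmetric, so \<open>V s\<close>
    collects its side from both orders of each pair. Then \<open>V s\<close> and \<open>V t\<close>
    lie in the two disjoint sets of \<open>q (s, t)\<close>. The factor \<open>topspace T\<close>
    covers an empty intersection.\<close>
  define V where "V s = topspace T \<inter> (\<Inter>t\<in>S - {s}. fst (q (s, t)) \<inter> snd (q (t, s)))" for s
  show thesis
  proof (rule that[of V])
    fix s assume s: "s \<in> S"
    have "openin T (topspace T \<inter> \<Inter>((\<lambda>t. fst (q (s, t)) \<inter> snd (q (t, s))) ` (S - {s})))"
      using q s S by (intro openin_Int_Inter) auto
    then show "openin T (V s) \<and> s \<in> V s"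
      using q s S(2) unfolding V_def by blast
  next
    show "disjoint_family_on V S"
      unfolding disjoint_family_on_def V_def using q by (fastforce simp: disjnt_def)
  qed
qed

locale regular_atlas =
  fixes n :: nat and X :: "'a topology" and A U :: "('a, 'z) fchart set"
  assumes space: "compact_polish_foliated_space n X A"
    and regular: "regular_foliated_atlas n X A U"
begin

abbreviation "E \<equiv> plaque_rel U"

text \<open>Local finiteness says nothing about charts with empty domain, so \<open>U\<close> may be
  infinite; only the remaining charts are counted.\<close>

definition charts where "charts = {c \<in> U. fdom c \<noteq> {}}"

lemma atlas: "foliated_atlas n X A"
  using space by (simp add: compact_polish_foliated_space_def)

lemma is_fchart: "c \<in> U \<Longrightarrow> is_fchart n X c"
  using regular by (simp add: regular_foliated_atlas_def foliated_atlas_def)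

lemma foliated_chart: "c \<in> U \<Longrightarrow> foliated_chart n X A c"
  using regular by (simp add: regular_foliated_atlas_def)

lemma cover: "(\<Union>c\<in>U. fdom c) = topspace X"
  using regular by (simp add: regular_foliated_atlas_def foliated_atlas_def)

text \<open>By compactness finitely many neighbourhoods, each meeting finitely many chart domains,
  cover \<open>X\<close>, and every nonempty domain meets one of them.\<close>

lemma finite_charts: "finite charts"
proof -
  have "\<forall>x\<in>topspace X. \<exists>N. openin X N \<and> x \<in> N \<and> finite {c\<in>U. fdom c \<inter> N \<noteq> {}}"
    using regular by (simp add: regular_foliated_atlas_def)
  then obtain N where N: "\<And>x. x \<in> topspace X \<Longrightarrow>
      openin X (N x) \<and> x \<in> N x \<and> finite {c\<in>U. fdom c \<inter> N x \<noteq> {}}"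
    unfolding bchoice_iff by blast
  have "compactin X (topspace X)"
    using space by (simp add: compact_polish_foliated_space_def compact_space_def)
  then obtain \<F> where \<F>: "finite \<F>" "\<F> \<subseteq> N ` topspace X" "topspace X \<subseteq> \<Union>\<F>"
    using compactinD[of X "topspace X" "N ` topspace X"] N by blast
  have "finite (\<Union>V\<in>\<F>. {c\<in>U. fdom c \<inter> V \<noteq> {}})"
    using \<F> N by auto
  moreover have "charts \<subseteq> (\<Union>V\<in>\<F>. {c\<in>U. fdom c \<inter> V \<noteq> {}})"
    using \<F>(3) cover unfolding charts_def by blast
  ultimately show ?thesis by (rule rev_finite_subset)
qed

lemma E_subset: "(x, y) \<in> E \<Longrightarrow> x \<in> topspace X \<and> y \<in> topspace X"
  using cover by (auto simp: plaque_rel_def)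

lemma E_refl: "x \<in> topspace X \<Longrightarrow> (x, x) \<in> E"
  using cover by (auto simp: plaque_rel_def)

lemma E_pow_subset: "x \<in> topspace X \<Longrightarrow> (x, y) \<in> E ^^ m \<Longrightarrow> y \<in> topspace X"
  by (cases m) (auto dest: E_subset)

lemma E_pow_sym: "(x, y) \<in> E ^^ m \<Longrightarrow> (y, x) \<in> E ^^ m"
  by (rule symD[OF sym_relpow[OF sym_plaque_rel]])

text \<open>\<open>E\<close> is reflexive on \<open>topspace X\<close>, so a path can be prolonged
  by constant steps: the \<open>m\<close>-th power describes what at most \<open>m\<close> steps
  reach.\<close>

lemma E_pow_mono:
  assumes "x \<in> topspace X" "m \<le> k" "(x, y) \<in> E ^^ m"
  shows "(x, y) \<in> E ^^ k"
  using assms(2)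
proof (induction k rule: dec_induct)
  case (step k)
  then show ?case
    using E_refl E_pow_subset[OF assms(1)] by auto
qed (rule assms(3))

section \<open>Saturation of open sets by plaques\<close>

lemma openin_plaque_rel_Image:
  assumes W: "openin X W"
  shows "openin X (E `` W)"
proof -
  have "E `` W = (\<Union>c\<in>U. {y \<in> fdom c. snd (fmap c y) \<in> (\<lambda>x. snd (fmap c x)) ` (fdom c \<inter> W)})"
    unfolding plaque_rel_def by (auto simp: image_iff) (metis Int_iff)+
  moreover have "openin (ftrans c) ((\<lambda>x. snd (fmap c x)) ` (fdom c \<inter> W))" if "c \<in> U" for c
  proof -
    have "openin (subtopology X (fdom c)) (fdom c \<inter> W)"
      using W by (rule openin_subtopology_Int2)
    then show ?thesis
      using open_map_transversal[OF is_fchart[OF that]] by (simp add: open_map_def)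
  qed
  ultimately show ?thesis
    using openin_transversal_vimage[OF is_fchart] by auto
qed

lemma openin_plaque_rel_pow_Image:
  "openin X W \<Longrightarrow> openin X ((E ^^ m) `` W)"
proof (induction m)
  case (Suc m)
  then show ?case using openin_plaque_rel_Image by (simp add: relcomp_Image)
qed simp

section \<open>Finiteness of the set of plaques meeting a ball\<close>

lemma adjacent_plaque_unique:
  assumes "c \<in> U" "d \<in> U" "P \<in> plaques c" "Q \<in> plaques d" "Q' \<in> plaques d"
    and "X closure_of P \<inter> X closure_of Q \<noteq> {}" "X closure_of P \<inter> X closure_of Q' \<noteq> {}"
  shows "Q = Q'"
proof -
  have "\<forall>c\<in>U. \<forall>d\<in>U. \<forall>P\<in>plaques c. \<forall>Q\<in>plaques d. \<forall>Q'\<in>plaques d.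
        X closure_of P \<inter> X closure_of Q \<noteq> {} \<and> X closure_of P \<inter> X closure_of Q' \<noteq> {}
          \<longrightarrow> Q = Q'"
    using regular by (simp add: regular_foliated_atlas_def)
  with assms show ?thesis by simp
qed

text \<open>By regularity a plaque meets at most one plaque of each chart. One more step therefore
  multiplies the number of labels by at most the number of nonempty charts.\<close>

lemma finite_ball_labels: "finite (ball_labels U x m)"
proof (induction m)
  case 0
  have "ball_labels U x 0 \<subseteq> (\<lambda>c. ftransversal_point c x) ` charts"
    by (auto simp: ball_labels_def charts_def)
  then show ?case using finite_charts finite_surj by blast
next
  case (Suc m)
  define near where "near l d = {k. fst k = d \<and> snd k \<in> topspace (ftrans d) \<and>
      label_plaque k \<inter> label_plaque l \<noteq> {}}" for l :: "('a, 'z) fchart \<times> 'z" and d :: "('a, 'z) fchart"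
  have "finite (near l d)" if l: "l \<in> ball_labels U x m" and d: "d \<in> charts" for l d
  proof -
    obtain c y where c: "l = ftransversal_point c y" "c \<in> U" "y \<in> fdom c"
      using l by (auto simp: ball_labels_def)
    have dU: "d \<in> U" using d by (simp add: charts_def)
    have P: "label_plaque l \<in> plaques c"
      using c transversal_in_ftrans[OF is_fchart]
      by (auto simp: plaques_def label_plaque_def ftransversal_point_def)
    have "k = k'" if k: "k \<in> near l d" "k' \<in> near l d" for k k'
    proof -
      have Q: "label_plaque k \<in> plaques d" "label_plaque k' \<in> plaques d"
        using k by (auto simp: near_def plaques_def label_plaque_def)
      have sub: "label_plaque j \<subseteq> X closure_of label_plaque j" if "fst j \<in> U" for j
        using fdom_subset[OF is_fchart[OF that]]
        by (intro closure_of_subset) (auto simp: label_plaque_def)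
      have "X closure_of label_plaque l \<inter> X closure_of label_plaque j \<noteq> {}" if "j \<in> near l d" for j
        using sub[of j] sub[of l] that c dU by (auto simp: near_def ftransversal_point_def)
      then have "label_plaque k = label_plaque k'"
        using adjacent_plaque_unique[OF c(2) dU P Q] k by blast
      \<comment> \<open>A common point of the two equal plaques determines the transversal
        coordinate, so the labels agree as well.\<close>
      moreover obtain y where y: "y \<in> label_plaque k"
        using k by (auto simp: near_def)
      ultimately have "y \<in> label_plaque k'" by simp
      with y show "k = k'"
        using k by (simp add: near_def label_plaque_def prod_eq_iff)
    qed
    then have "\<exists>k. near l d \<subseteq> {k}" by blast
    then show ?thesis using finite_subset by blast
  qed
  then have "finite (\<Union>l\<in>ball_labels U x m. \<Union>d\<in>charts. near l d)"
    using Suc finite_charts by blast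
  moreover have "ball_labels U x (Suc m) \<subseteq> (\<Union>l\<in>ball_labels U x m. \<Union>d\<in>charts. near l d)"
  proof
    fix k assume "k \<in> ball_labels U x (Suc m)"
    then obtain d y y' where d: "k = ftransversal_point d y" "d \<in> U" "y \<in> fdom d"
      and y: "(x, y') \<in> E ^^ m" "(y', y) \<in> E"
      by (auto simp: ball_labels_def)
    then obtain c where c: "c \<in> U" "y' \<in> fdom c" "y \<in> fdom c" "snd (fmap c y') = snd (fmap c y)"
      by (auto simp: plaque_rel_def)
    \<comment> \<open>The plaque of \<open>c\<close> through \<open>y'\<close> and \<open>y\<close>
      already meets the smaller ball at \<open>y'\<close>, and it meets the plaque labelled
      \<open>k\<close> at \<open>y\<close>.\<close>
    have "ftransversal_point c y' \<in> ball_labels U x m"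
      using c y by (auto simp: ball_labels_def)
    moreover have "k \<in> near (ftransversal_point c y') d"
      using c d transversal_in_ftrans[OF is_fchart]
      by (auto simp: near_def label_plaque_def ftransversal_point_def)
    moreover have "d \<in> charts" using d by (auto simp: charts_def)
    ultimately show "k \<in> (\<Union>l\<in>ball_labels U x m. \<Union>d\<in>charts. near l d)" by blast
  qed
  ultimately show ?case by (rule rev_finite_subset)
qed

section \<open>Lower semicontinuity of the number of labels\<close>

lemma openin_card_ball_labels_ge:
  "openin X {x \<in> topspace X. k \<le> card (ball_labels U x m)}"
proof (subst openin_subopen, intro ballI)
  fix x assume "x \<in> {x \<in> topspace X. k \<le> card (ball_labels U x m)}"
  then have x: "x \<in> topspace X" "k \<le> card (ball_labels U x m)" by auto
  let ?L = "ball_labels U x m"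
  \<comment> \<open>Coordinates are separated one chart at a time; labels in different charts are
    distinct anyway.\<close>
  have "\<exists>V. (\<forall>z. (c, z) \<in> ?L \<longrightarrow> openin (ftrans c) (V z) \<and> z \<in> V z) \<and>
      disjoint_family_on V {z. (c, z) \<in> ?L}" for c
  proof (cases "c \<in> U")
    case True
    have "finite (snd ` ?L)" using finite_ball_labels by blast
    then have "finite {z. (c, z) \<in> ?L}"
      by (rule rev_finite_subset) force
    moreover have "{z. (c, z) \<in> ?L} \<subseteq> topspace (ftrans c)"
      using transversal_in_ftrans[OF is_fchart[OF True]]
      by (auto simp: ball_labels_def ftransversal_point_def)
    ultimately obtain V where "\<And>z. z \<in> {z. (c, z) \<in> ?L} \<Longrightarrow> openin (ftrans c) (V z) \<and> z \<in> V z"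
        "disjoint_family_on V {z. (c, z) \<in> ?L}"
      using Hausdorff_finite_separation[OF Hausdorff_ftrans[OF is_fchart[OF True]]] by metis
    then show ?thesis by auto
  next
    case False
    then have "{z. (c, z) \<in> ?L} = {}"
      by (auto simp: ball_labels_def ftransversal_point_def)
    then show ?thesis by (auto simp: disjoint_family_on_def)
  qed
  then obtain V where V: "\<And>c z. (c, z) \<in> ?L \<Longrightarrow> openin (ftrans c) (V c z) \<and> z \<in> V c z"
    and disj: "\<And>c. disjoint_family_on (V c) {z. (c, z) \<in> ?L}"
    by metis
  \<comment> \<open>\<open>O' l\<close> is an open transversal thickening of the plaque labelled
    \<open>l\<close>. Since the powers of \<open>E\<close> are symmetric, \<open>W\<close> consists
    of the points whose \<open>m\<close>-step ball meets every one of these thickenings.\<close>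
  define O' where "O' l = {y \<in> fdom (fst l). snd (fmap (fst l) y) \<in> V (fst l) (snd l)}"
    for l :: "('a, 'z) fchart \<times> 'z"
  define W where "W = topspace X \<inter> \<Inter>((\<lambda>l. (E ^^ m) `` O' l) ` ?L)"
  have LU: "fst l \<in> U" if "l \<in> ?L" for l
    using that by (auto simp: ball_labels_def ftransversal_point_def)
  have "openin X (O' l)" if "l \<in> ?L" for l
    unfolding O'_def using V[of "fst l" "snd l"] that
    by (intro openin_transversal_vimage[OF is_fchart[OF LU[OF that]]]) auto
  then have "openin X W"
    unfolding W_def using openin_plaque_rel_pow_Image finite_ball_labels
    by (intro openin_Int_Inter) auto
  moreover have "x \<in> W"
  proof -
    have "x \<in> (E ^^ m) `` O' l" if l: "l \<in> ?L" for l
    proof -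
      obtain c y where c: "l = (c, snd (fmap c y))" "y \<in> fdom c" "(x, y) \<in> E ^^ m"
        using l by (auto simp: ball_labels_def ftransversal_point_def)
      then have "y \<in> O' l" using V[of c "snd (fmap c y)"] l by (simp add: O'_def)
      then show ?thesis using E_pow_sym[OF c(3)] by blast
    qed
    then show ?thesis using x by (auto simp: W_def)
  qed
  moreover have "k \<le> card (ball_labels U x' m)" if x': "x' \<in> W" for x'
  proof -
    have "\<exists>l'\<in>ball_labels U x' m. fst l' = fst l \<and> snd l' \<in> V (fst l) (snd l)" if l: "l \<in> ?L" for l
    proof -
      obtain y where y: "y \<in> O' l" "(y, x') \<in> E ^^ m"
        using x' l by (auto simp: W_def)
      then have "ftransversal_point (fst l) y \<in> ball_labels U x' m"
        using E_pow_sym[OF y(2)] LU[OF l] by (auto simp: ball_labels_def O'_def)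
      then show ?thesis
        using y(1) by (intro bexI[of _ "ftransversal_point (fst l) y"])
          (auto simp: O'_def ftransversal_point_def)
    qed
    then obtain f where f: "\<And>l. l \<in> ?L \<Longrightarrow>
        f l \<in> ball_labels U x' m \<and> fst (f l) = fst l \<and> snd (f l) \<in> V (fst l) (snd l)"
      by metis
    \<comment> \<open>\<open>f\<close> preserves the chart, and within one chart it sends distinct
      labels into disjoint sets \<open>V\<close>.\<close>
    have "inj_on f ?L"
    proof (rule inj_onI)
      fix l l' assume l: "l \<in> ?L" "l' \<in> ?L" and eq: "f l = f l'"
      then have fst: "fst l = fst l'" using f by metis
      then have "snd (f l) \<in> V (fst l) (snd l) \<inter> V (fst l) (snd l')"
        using f[OF l(1)] f[OF l(2)] eq by auto
      then have "snd l = snd l'"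
        using disj[of "fst l"] l fst unfolding disjoint_family_on_def
        by (metis (no_types, lifting) empty_iff mem_Collect_eq prod.collapse)
      with fst show "l = l'" by (simp add: prod_eq_iff)
    qed
    then have "card ?L \<le> card (ball_labels U x' m)"
      using f by (intro card_inj_on_le[of f]) (auto simp: finite_ball_labels)
    with x(2) show ?thesis by simp
  qed
  moreover have "W \<subseteq> topspace X" by (auto simp: W_def)
  ultimately show "\<exists>T. openin X T \<and> x \<in> T \<and> T \<subseteq> {x \<in> topspace X. k \<le> card (ball_labels U x m)}"
    by blast
qed

section \<open>Chains of plaques and connectedness in the leaf topology\<close>

lemma openin_leaf_topology_plaque: "P \<in> atlas_plaques U \<Longrightarrow> openin (leaf_topology n X A) P"
  unfolding leaf_topology_def atlas_plaques_def using foliated_chart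
  by (intro topology_generated_by_Basis) blast

lemma connectedin_plaque: "P \<in> atlas_plaques U \<Longrightarrow> connectedin (leaf_topology n X A) P"
  using connectedin_leaf_topology_plaque[OF atlas foliated_chart] by (auto simp: atlas_plaques_def)

lemma atlas_plaque_nonempty:
  assumes "P \<in> atlas_plaques U"
  shows "P \<noteq> {}"
proof -
  obtain c z where c: "c \<in> U" "z \<in> topspace (ftrans c)" "P = {x \<in> fdom c. snd (fmap c x) = z}"
    using assms by (auto simp: atlas_plaques_def plaques_def)
  show ?thesis
    using plaque_nonempty[OF is_fchart[OF c(1)] c(2)] c(3) by auto
qed

lemma plaque_relE:
  assumes "(x, y) \<in> E"
  obtains P where "P \<in> atlas_plaques U" "x \<in> P" "y \<in> P"
proof -
  obtain c where c: "c \<in> U" "x \<in> fdom c" "y \<in> fdom c" "snd (fmap c x) = snd (fmap c y)"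
    using assms by (auto simp: plaque_rel_def)
  show thesis
    by (rule that[of "{q \<in> fdom c. snd (fmap c q) = snd (fmap c x)}"])
      (use c transversal_in_ftrans[OF is_fchart[OF c(1)]] in \<open>auto simp: atlas_plaques_def plaques_def\<close>)
qed

text \<open>Consecutive plaques along a path share a point, so their union is connected. The
  exponent is a successor because an empty family covers no point; the cardinality is only bounded
  because plaques may repeat.\<close>

lemma plaque_chain:
  assumes "(x, y) \<in> E ^^ Suc m"
  obtains \<P> where "\<P> \<subseteq> atlas_plaques U" "finite \<P>" "card \<P> \<le> Suc m"
    "connectedin (leaf_topology n X A) (\<Union>\<P>)" "x \<in> \<Union>\<P>" "y \<in> \<Union>\<P>"
  using assms
proof (induction m arbitrary: y thesis)
  case 0
  then have "(x, y) \<in> E" by simp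
  from plaque_relE[OF this] obtain P where P: "P \<in> atlas_plaques U" "x \<in> P" "y \<in> P" .
  then show ?case
    by (intro 0(1)[of "{P}"]) (auto intro: connectedin_plaque)
next
  case (Suc m)
  obtain y' where y': "(x, y') \<in> E ^^ Suc m" "(y', y) \<in> E"
    using Suc.prems(2) by (auto elim: relpow_Suc_E)
  obtain \<P> where \<P>: "\<P> \<subseteq> atlas_plaques U" "finite \<P>" "card \<P> \<le> Suc m"
    "connectedin (leaf_topology n X A) (\<Union>\<P>)" "x \<in> \<Union>\<P>" "y' \<in> \<Union>\<P>"
    using Suc.IH[OF _ y'(1)] by metis
  obtain P where P: "P \<in> atlas_plaques U" "y' \<in> P" "y \<in> P"
    using plaque_relE[OF y'(2)] by metis
  have "connectedin (leaf_topology n X A) (P \<union> \<Union>\<P>)"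
    using \<P> P connectedin_plaque by (intro connectedin_Un) auto
  moreover have "card (insert P \<P>) \<le> Suc (Suc m)"
    using \<P> by (simp add: card_insert_if)
  ultimately show ?case
    using \<P> P by (intro Suc.prems(1)[of "insert P \<P>"]) auto
qed

text \<open>A subfamily starting with a plaque through \<open>x\<close> is enlarged one plaque at a
  time. Plaques are open and nonempty in the leaf topology, so the chosen and the remaining ones
  would disconnect the union unless some remaining plaque meets a chosen one; that plaque costs one
  more step.\<close>

lemma connected_plaques_subset:
  assumes \<P>: "\<P> \<subseteq> atlas_plaques U" "finite \<P>" "connectedin (leaf_topology n X A) (\<Union>\<P>)"
    and x: "x \<in> \<Union>\<P>"
  shows "\<Union>\<P> \<subseteq> (E ^^ card \<P>) `` {x}"
proof -
  have xX: "x \<in> topspace X"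
  proof -
    obtain P where "P \<in> \<P>" "x \<in> P" using x by blast
    then show ?thesis using \<P>(1) plaque_relI[of P U x x] E_subset[of x x] by blast
  qed
  have "\<exists>\<Q>\<subseteq>\<P>. card \<Q> = Suc j \<and> \<Union>\<Q> \<subseteq> (E ^^ Suc j) `` {x}" if "Suc j \<le> card \<P>" for j
    using that
  proof (induction j)
    case 0
    obtain P where "P \<in> \<P>" "x \<in> P" using x by blast
    then show ?case
      using \<P>(1) plaque_relI[of P U x] by (intro exI[of _ "{P}"]) auto
  next
    case (Suc j)
    then obtain \<Q> where \<Q>: "\<Q> \<subseteq> \<P>" "card \<Q> = Suc j" "\<Union>\<Q> \<subseteq> (E ^^ Suc j) `` {x}"
      by auto
    have fin: "finite \<Q>" using \<Q>(1) \<P>(2) finite_subset by blast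
    have "\<P> - \<Q> \<noteq> {}" using \<Q> Suc.prems by auto
    moreover have "\<Q> \<noteq> {}" using \<Q>(2) by auto
    ultimately have "\<Union>\<Q> \<inter> \<Union>\<P> \<noteq> {}" "\<Union>(\<P> - \<Q>) \<inter> \<Union>\<P> \<noteq> {}"
      using atlas_plaque_nonempty \<P>(1) \<Q>(1) by blast+
    moreover have "openin (leaf_topology n X A) (\<Union>\<Q>)" "openin (leaf_topology n X A) (\<Union>(\<P> - \<Q>))"
      using \<P>(1) \<Q>(1) openin_leaf_topology_plaque by (auto intro!: openin_Union)
    moreover have "\<Union>\<P> \<subseteq> \<Union>\<Q> \<union> \<Union>(\<P> - \<Q>)" by blast
    ultimately have "\<Union>\<Q> \<inter> \<Union>(\<P> - \<Q>) \<inter> \<Union>\<P> \<noteq> {}"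
      using conjunct2[OF \<P>(3)[unfolded connectedin]] by metis
    then obtain y where "y \<in> \<Union>\<Q>" "y \<in> \<Union>(\<P> - \<Q>)" by auto
    then obtain P where P: "P \<in> \<P>" "P \<notin> \<Q>" "y \<in> P" "y \<in> \<Union>\<Q>" by auto
    have "P \<subseteq> (E ^^ Suc (Suc j)) `` {x}"
    proof
      fix w assume "w \<in> P"
      then have "(y, w) \<in> E" using P(1,3) \<P>(1) plaque_relI[of P U y w] by auto
      then show "w \<in> (E ^^ Suc (Suc j)) `` {x}"
        using P(4) \<Q>(3) relpow_Suc_I[of x y "Suc j" E w] by blast
    qed
    moreover have "\<Union>\<Q> \<subseteq> (E ^^ Suc (Suc j)) `` {x}"
      using \<Q>(3) E_pow_mono[OF xX le_SucI[OF order_refl]] by blast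
    ultimately show ?case
      using P \<Q> fin by (intro exI[of _ "insert P \<Q>"]) auto
  qed
  \<comment> \<open>Some plaque contains \<open>x\<close>, so the cardinality is positive, and at
    this index the subfamily exhausts the whole family.\<close>
  from this[of "card \<P> - 1"] obtain \<Q> where "\<Q> \<subseteq> \<P>" "card \<Q> = card \<P>" "\<Union>\<Q> \<subseteq> (E ^^ card \<P>) `` {x}"
    using x \<P>(2) by (metis Suc_pred' UnionE card_gt_0_iff empty_iff order_refl)
  then show ?thesis using card_subset_eq[OF \<P>(2)] by metis
qed

lemma topspace_leaf_topology: "topspace (leaf_topology n X A) = topspace X"
proof
  show "topspace (leaf_topology n X A) \<subseteq> topspace X"
    unfolding leaf_topology_def topology_generated_by_topspace
    by (auto simp: foliated_chart_def plaques_def dest!: fdom_subset)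
  show "topspace X \<subseteq> topspace (leaf_topology n X A)"
    using E_refl plaque_relE openin_subset[OF openin_leaf_topology_plaque] by (metis subsetD subsetI)
qed

lemma openin_leaf_topology_E_Image: "openin (leaf_topology n X A) (E `` S)"
proof (subst openin_subopen, intro ballI)
  fix y assume "y \<in> E `` S"
  then obtain x P where "x \<in> S" "P \<in> atlas_plaques U" "x \<in> P" "y \<in> P"
    using plaque_relE by blast
  moreover from this have "P \<subseteq> E `` S"
    using plaque_relI[of P U x] by blast
  ultimately show "\<exists>T. openin (leaf_topology n X A) T \<and> y \<in> T \<and> T \<subseteq> E `` S"
    using openin_leaf_topology_plaque by metis
qed

text \<open>Chains connect the points of a class of \<open>E\<^sup>*\<close>. Conversely, the class
  and its complement in \<open>topspace X\<close> are both unions of plaques, hence open in the leaf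
  topology, so the component of \<open>x\<close> cannot leave the class.\<close>

lemma leaf_eq:
  assumes x: "x \<in> topspace X"
  shows "leaf n X A x = E\<^sup>* `` {x}"
proof
  let ?T = "leaf_topology n X A"
  show "E\<^sup>* `` {x} \<subseteq> leaf n X A x"
  proof
    fix y assume "y \<in> E\<^sup>* `` {x}"
    then obtain m where "(x, y) \<in> E ^^ m" by (auto simp: rtrancl_is_UN_relpow)
    then have "(x, y) \<in> E ^^ Suc m" using E_pow_mono[OF x] by (metis le_SucI order_refl)
    then show "y \<in> leaf n X A x"
      unfolding leaf_def mem_Collect_eq connected_component_of_def by (rule plaque_chain) blast
  qed
  let ?S = "E\<^sup>* `` {x}"
  have S: "E `` ?S = ?S"
  proof
    show "?S \<subseteq> E `` ?S"
    proof
      fix y assume y: "y \<in> ?S"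
      then have "y \<in> topspace X"
        using x E_pow_subset by (auto simp: rtrancl_is_UN_relpow)
      then show "y \<in> E `` ?S" using E_refl y by blast
    qed
  qed (auto intro: rtrancl_into_rtrancl)
  have comp: "E `` (topspace X - ?S) = topspace X - ?S"
  proof
    show "E `` (topspace X - ?S) \<subseteq> topspace X - ?S"
    proof
      fix y assume "y \<in> E `` (topspace X - ?S)"
      then obtain w where w: "w \<in> topspace X" "w \<notin> ?S" "(w, y) \<in> E" by blast
      then have "(y, w) \<in> E" using sym_plaque_rel by (metis symD)
      then show "y \<in> topspace X - ?S"
        using w E_subset by (auto intro: rtrancl_into_rtrancl)
    qed
  qed (use E_refl in blast)
  have "connectedin ?T (leaf n X A x)"
    unfolding leaf_def by (rule connectedin_connected_component_of)
  moreover have "openin ?T ?S" "openin ?T (topspace X - ?S)"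
    using openin_leaf_topology_E_Image S comp by metis+
  moreover have "leaf n X A x \<subseteq> topspace X"
    unfolding leaf_def using connected_component_of_subset_topspace topspace_leaf_topology by metis
  moreover have "x \<in> leaf n X A x"
    using x by (simp add: leaf_def connected_component_of_refl topspace_leaf_topology)
  ultimately show "leaf n X A x \<subseteq> ?S"
    unfolding connectedin by blast
qed

section \<open>Plaque distance and growth in terms of powers of the plaque relation\<close>

text \<open>A connected family of \<open>k\<close> plaques gives a path of \<open>k\<close> steps,
  and a path between distinct points gives a connected family of at most \<open>k\<close> plaques.
  Equal points are treated apart: their distance is 0 by convention, although any family covering
  them is nonempty.\<close>

lemma plaque_dist_le_iff:
  assumes x: "x \<in> topspace X" and y: "y \<in> leaf n X A x"
  shows "plaque_dist n X A U x y \<le> m \<longleftrightarrow> (x, y) \<in> E ^^ m"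
proof (cases "x = y")
  case True
  then show ?thesis
    using E_pow_mono[OF x, of 0 m y] by (simp add: plaque_dist_def)
next
  case False
  define chain where "chain k \<longleftrightarrow> (\<exists>\<P>. \<P> \<subseteq> atlas_plaques U \<and> finite \<P> \<and> card \<P> = k \<and>
        connectedin (leaf_topology n X A) (\<Union>\<P>) \<and> x \<in> \<Union>\<P> \<and> y \<in> \<Union>\<P>)" for k
  have dist: "plaque_dist n X A U x y = Least chain"
    using False unfolding plaque_dist_def chain_def by simp
  have pow: "(x, y) \<in> E ^^ k" if "chain k" for k
    using that connected_plaques_subset unfolding chain_def by blast
  have chain: "\<exists>j\<le>k. chain j" if k: "(x, y) \<in> E ^^ k" for k
  proof -
    obtain k' where "k = Suc k'" using k False by (cases k) auto
    then show ?thesis using plaque_chain[of x y k'] k unfolding chain_def by metis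
  qed
  \<comment> \<open>Membership in the leaf provides a chain, so the \<open>LEAST\<close> in the
    distance is attained.\<close>
  obtain k where "(x, y) \<in> E ^^ k"
    using y leaf_eq[OF x] by (auto simp: rtrancl_is_UN_relpow)
  then have "chain (Least chain)" using chain LeastI by metis
  then show ?thesis
    unfolding dist using pow chain E_pow_mono[OF x] by (metis Least_le order_trans)
qed

lemma leaf_ball_eq:
  assumes x: "x \<in> topspace X" and r: "r > 0"
  shows "leaf_ball n X A U x r = (E ^^ (nat \<lceil>r\<rceil> - 1)) `` {x}"
proof -
  \<comment> \<open>The ball is open and distances are integers, hence the shift by one after
    rounding up.\<close>
  have "real d < r \<longleftrightarrow> d \<le> nat \<lceil>r\<rceil> - 1" for d
    using r by linarith
  then have "leaf_ball n X A U x r =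
      {y \<in> leaf n X A x. plaque_dist n X A U x y \<le> nat \<lceil>r\<rceil> - 1}"
    by (simp add: leaf_ball_def)
  also have "\<dots> = leaf n X A x \<inter> (E ^^ (nat \<lceil>r\<rceil> - 1)) `` {x}"
    using plaque_dist_le_iff[OF x] by blast
  also have "\<dots> = (E ^^ (nat \<lceil>r\<rceil> - 1)) `` {x}"
    using leaf_eq[OF x] by (auto simp: rtrancl_is_UN_relpow)
  finally show ?thesis .
qed

lemma leaf_growth_eq:
  assumes x: "x \<in> topspace X" and r: "r > 0"
  shows "leaf_growth n X A U x r = card (label_plaque ` ball_labels U x (nat \<lceil>r\<rceil> - 1))"
proof -
  let ?B = "(E ^^ (nat \<lceil>r\<rceil> - 1)) `` {x}"
  have "{P \<in> atlas_plaques U. P \<inter> ?B \<noteq> {}} = label_plaque ` ball_labels U x (nat \<lceil>r\<rceil> - 1)"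
  proof (intro equalityI subsetI)
    fix P assume "P \<in> {P \<in> atlas_plaques U. P \<inter> ?B \<noteq> {}}"
    then obtain c y where "c \<in> U" "y \<in> fdom c" "(x, y) \<in> E ^^ (nat \<lceil>r\<rceil> - 1)"
        "P = label_plaque (ftransversal_point c y)"
      by (auto simp: atlas_plaques_def plaques_def label_plaque_def ftransversal_point_def)
    then show "P \<in> label_plaque ` ball_labels U x (nat \<lceil>r\<rceil> - 1)"
      by (auto simp: ball_labels_def)
  next
    fix P assume "P \<in> label_plaque ` ball_labels U x (nat \<lceil>r\<rceil> - 1)"
    then obtain c y where c: "c \<in> U" "y \<in> fdom c" "(x, y) \<in> E ^^ (nat \<lceil>r\<rceil> - 1)"
        "P = {q \<in> fdom c. snd (fmap c q) = snd (fmap c y)}"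
      by (auto simp: ball_labels_def label_plaque_def ftransversal_point_def)
    then have "P \<in> plaques c"
      using transversal_in_ftrans[OF is_fchart] by (auto simp: plaques_def)
    then show "P \<in> {P \<in> atlas_plaques U. P \<inter> ?B \<noteq> {}}"
      using c by (auto simp: atlas_plaques_def)
  qed
  then show ?thesis by (simp add: leaf_growth_def leaf_ball_eq[OF x r])
qed

text \<open>A label is recovered from its chart and its plaque, the plaque being nonempty. So
  counting labels instead of plaques costs at most the factor \<open>card charts\<close>, which
  growth types ignore.\<close>

lemma card_ball_labels_le:
  "card (ball_labels U x m) \<le> card charts * card (label_plaque ` ball_labels U x m)"
proof -
  have "inj_on (\<lambda>l. (fst l, label_plaque l)) (ball_labels U x m)"
    by (rule inj_onI) (auto simp: ball_labels_def label_plaque_def ftransversal_point_def)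
  then have "card (ball_labels U x m) \<le> card (charts \<times> label_plaque ` ball_labels U x m)"
  proof (rule card_inj_on_le)
    show "(\<lambda>l. (fst l, label_plaque l)) ` ball_labels U x m \<subseteq> charts \<times> label_plaque ` ball_labels U x m"
      by (auto simp: charts_def) (auto simp: ball_labels_def ftransversal_point_def)
    show "finite (charts \<times> label_plaque ` ball_labels U x m)"
      using finite_charts finite_ball_labels by blast
  qed
  then show ?thesis by (simp add: card_cartesian_product)
qed

lemma ball_labels_mono:
  "x \<in> topspace X \<Longrightarrow> m \<le> k \<Longrightarrow> ball_labels U x m \<subseteq> ball_labels U x k"
  using E_pow_mono by (fastforce simp: ball_labels_def)

end

section \<open>Borel sets and the Baire property\<close>

lemma borel_subset_measure: "borel_subset T S \<longleftrightarrow> S \<in> sets (sigma (topspace T) {V. openin T V})"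
  by (subst sets_measure_of) (auto simp: borel_subset_def dest: openin_subset)

lemma space_sigma_openin: "space (sigma (topspace T) {V. openin T V}) = topspace T"
  by (rule space_measure_of) (auto dest: openin_subset)

lemma borel_subset_topspace: "borel_subset T S \<Longrightarrow> S \<subseteq> topspace T"
  unfolding borel_subset_def
  by (rule sigma_sets_into_sp[of "{V. openin T V}"]) (auto dest: openin_subset)

lemma borel_subset_continuous_preimage:
  assumes f: "continuous_map S T f" and B: "borel_subset T B"
  shows "borel_subset S {x \<in> topspace S. f x \<in> B}"
  using B unfolding borel_subset_def
proof (induction rule: sigma_sets.induct)
  case (Basic V)
  then show ?case
    using openin_continuous_map_preimage[OF f] by (auto intro: sigma_sets.Basic)
next
  case Empty
  show ?case using sigma_sets.Empty by simp
next
  case (Compl B)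
  have "{x \<in> topspace S. f x \<in> topspace T - B} = topspace S - {x \<in> topspace S. f x \<in> B}"
    using continuous_map_image_subset_topspace[OF f] by auto
  then show ?case using sigma_sets.Compl[OF Compl.IH] by simp
next
  case (Union B)
  have "{x \<in> topspace S. f x \<in> \<Union>(range B)} = (\<Union>i. {x \<in> topspace S. f x \<in> B i})" by auto
  then show ?case using sigma_sets.Union[OF Union.IH] by simp
qed

text \<open>Equivalence classes are sections of the relation, and a section is the preimage under
  the continuous map sending \<open>y\<close> to \<open>(x, y)\<close>.\<close>

lemma borel_subset_section:
  assumes B: "borel_subset (prod_topology S T) B"
  shows "borel_subset T (B `` {x})"
proof -
  have sub: "B \<subseteq> topspace S \<times> topspace T"
    using borel_subset_topspace[OF B] by simp
  show ?thesis
  proof (cases "x \<in> topspace S")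
    case True
    then have "continuous_map T (prod_topology S T) (\<lambda>y. (x, y))"
      by (intro continuous_map_pairedI) auto
    from borel_subset_continuous_preimage[OF this B]
    have "borel_subset T {y \<in> topspace T. (x, y) \<in> B}" .
    moreover have "{y \<in> topspace T. (x, y) \<in> B} = B `` {x}"
      using sub by auto
    ultimately show ?thesis by simp
  next
    case False
    then have "B `` {x} = {}" using sub by auto
    then show ?thesis by (simp add: borel_subset_def sigma_sets.Empty)
  qed
qed

section \<open>Meager sets and the Baire property of Borel sets\<close>

lemma nowhere_dense_in_subset: "nowhere_dense_in T N \<Longrightarrow> M \<subseteq> N \<Longrightarrow> nowhere_dense_in T M"
  unfolding nowhere_dense_in_def
  by (metis closure_of_mono interior_of_mono order_trans subset_empty)

lemma meager_in_subset:
  assumes "meager_in T S" "R \<subseteq> S"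
  shows "meager_in T R"
proof -
  obtain \<N> where \<N>: "countable \<N>" "\<forall>N\<in>\<N>. nowhere_dense_in T N" "S = \<Union>\<N>"
    using assms(1) by (auto simp: meager_in_def)
  show ?thesis
    unfolding meager_in_def
    by (rule exI[of _ "(\<lambda>N. N \<inter> R) ` \<N>"])
      (use \<N> assms(2) in \<open>auto intro: nowhere_dense_in_subset\<close>)
qed

lemma meager_in_UN:
  assumes "countable I" "\<And>i. i \<in> I \<Longrightarrow> meager_in T (S i)"
  shows "meager_in T (\<Union>i\<in>I. S i)"
proof -
  have *: "\<forall>i\<in>I. \<exists>\<N>. countable \<N> \<and> (\<forall>N\<in>\<N>. nowhere_dense_in T N) \<and> S i = \<Union>\<N>"
    using assms(2) by (simp add: meager_in_def)
  obtain \<N> where "\<forall>i\<in>I. countable (\<N> i) \<and> (\<forall>N\<in>\<N> i. nowhere_dense_in T N) \<and> S i = \<Union>(\<N> i)"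
    using bchoice[OF *] by (elim exE) (rule that)
  with assms(1) show ?thesis
    unfolding meager_in_def by (intro exI[of _ "\<Union>i\<in>I. \<N> i"]) auto
qed

lemma meager_in_Un: "meager_in T S \<Longrightarrow> meager_in T R \<Longrightarrow> meager_in T (S \<union> R)"
  using meager_in_UN[of "{S, R}" T id] by auto

text \<open>An open subset of this boundary would lie in \<open>F\<close>, hence in its interior,
  from which the boundary is disjoint.\<close>

lemma nowhere_dense_in_closed_diff_interior:
  assumes "closedin T F"
  shows "nowhere_dense_in T (F - T interior_of F)"
proof -
  have "closedin T (F - T interior_of F)"
    using assms by (intro closedin_diff) auto
  moreover have "T interior_of (F - T interior_of F) = {}"
    using interior_of_mono[of "F - T interior_of F" F T]
      interior_of_subset[of T "F - T interior_of F"] by blast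
  ultimately show ?thesis
    using closedin_subset by (fastforce simp: nowhere_dense_in_def closure_of_closedin)
qed

text \<open>The sets with the Baire property contain the open sets and are closed under complements
  and countable unions.\<close>

lemma borel_imp_baire_subset:
  assumes "borel_subset T S"
  shows "baire_subset T S"
  using assms unfolding borel_subset_def
proof (induction rule: sigma_sets.induct)
  case (Basic V)
  moreover have "meager_in T {}"
    unfolding meager_in_def by (intro exI[of _ "{}"]) auto
  ultimately show ?case
    using openin_subset unfolding baire_subset_def by (intro conjI exI[of _ V]) auto
next
  case Empty
  moreover have "meager_in T {}"
    unfolding meager_in_def by (intro exI[of _ "{}"]) auto
  ultimately show ?case
    unfolding baire_subset_def by (intro conjI exI[of _ "{}"]) auto
next
  case (Compl S)
  then obtain V where S: "S \<subseteq> topspace T" and V: "openin T V" "meager_in T (sym_diff S V)"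
    by (auto simp: baire_subset_def)
  \<comment> \<open>The complement of \<open>V\<close> is closed but need not be open; passing to
    its interior changes it only by a nowhere dense boundary.\<close>
  define F where "F = topspace T - V"
  have "closedin T F" using V by (auto simp: F_def)
  then have "nowhere_dense_in T (F - T interior_of F)"
    by (rule nowhere_dense_in_closed_diff_interior)
  then have "meager_in T (F - T interior_of F)"
    unfolding meager_in_def by (intro exI[of _ "{F - T interior_of F}"]) auto
  then have "meager_in T (sym_diff S V \<union> (F - T interior_of F))"
    by (rule meager_in_Un[OF V(2)])
  moreover have "sym_diff (topspace T - S) (T interior_of F) \<subseteq> sym_diff S V \<union> (F - T interior_of F)"
    using interior_of_subset[of T F] by (auto simp: F_def)
  ultimately show ?case
    unfolding baire_subset_def
    by (intro conjI exI[of _ "T interior_of F"]) (auto intro: meager_in_subset)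
next
  case (Union S)
  then have "\<forall>i. \<exists>V. openin T V \<and> meager_in T (sym_diff (S i) V)"
    by (auto simp: baire_subset_def)
  then obtain V where V: "\<And>i. openin T (V i)" "\<And>i. meager_in T (sym_diff (S i) (V i))"
    by metis
  have "meager_in T (\<Union>i. sym_diff (S i) (V i))"
    by (rule meager_in_UN) (auto simp: V)
  then have "meager_in T (sym_diff (\<Union>(range S)) (\<Union>(range V)))"
    by (rule meager_in_subset) auto
  moreover have "openin T (\<Union>(range V))" using V(1) by auto
  moreover have "\<Union>(range S) \<subseteq> topspace T"
    using Union.IH by (auto simp: baire_subset_def)
  ultimately show ?case by (auto simp: baire_subset_def)
qed

section \<open>The growth relation\<close>

text \<open>The functions \<open>f\<close> and \<open>g\<close> stand for label counts, and
  \<open>K\<close> bounds the overcounting. Real constants are rounded up in one direction; in the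
  other, monotonicity absorbs the rounding of the radius.\<close>

lemma growth_dominated_iff_nat:
  fixes u v :: "real \<Rightarrow> real" and f g :: "nat \<Rightarrow> nat"
  assumes mono: "mono f" "mono g" and K: "K > 0"
    and u: "\<And>r. r > 0 \<Longrightarrow> u r \<le> f (nat \<lceil>r\<rceil>)" "\<And>r. r > 0 \<Longrightarrow> f (nat \<lceil>r\<rceil>) \<le> K * u r"
    and v: "\<And>r. r > 0 \<Longrightarrow> v r \<le> g (nat \<lceil>r\<rceil>)" "\<And>r. r > 0 \<Longrightarrow> g (nat \<lceil>r\<rceil>) \<le> K * v r"
  shows "growth_dominated u v \<longleftrightarrow> (\<exists>a b c. \<forall>k\<ge>c. f k \<le> a * g (b * k))"
proof
  assume "growth_dominated u v"
  then obtain a b c where abc: "a \<ge> 1" "b \<ge> 1" "c > 0" "\<And>r. r \<ge> c \<Longrightarrow> u r \<le> a * v (b * r)"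
    by (auto simp: growth_dominated_def)
  have "f k \<le> nat \<lceil>K * a\<rceil> * g (nat \<lceil>b\<rceil> * k)" if k: "k \<ge> nat \<lceil>c\<rceil>" for k
  proof -
    have kc: "real k \<ge> c" "k > 0" using k abc(3) by linarith+
    have "nat \<lceil>b * real k\<rceil> \<le> nat \<lceil>b\<rceil> * k"
    proof -
      have "b * real k \<le> real (nat \<lceil>b\<rceil>) * real k"
        by (intro mult_right_mono) linarith+
      then show ?thesis
        by (metis ceiling_le nat_le_iff of_int_of_nat_eq of_nat_mult)
    qed
    then have g: "g (nat \<lceil>b * real k\<rceil>) \<le> g (nat \<lceil>b\<rceil> * k)"
      using mono by (simp add: monoD)
    have "real (f k) \<le> K * u k"
      using u(2)[of "real k"] kc by simp
    also have "\<dots> \<le> K * (a * v (b * k))"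
      using abc(4)[OF kc(1)] K by simp
    also have "\<dots> = (K * a) * v (b * k)" by simp
    also have "\<dots> \<le> (K * a) * g (nat \<lceil>b * real k\<rceil>)"
      using v(1)[of "b * k"] kc abc K by (intro mult_left_mono) auto
    also have "\<dots> \<le> (K * a) * g (nat \<lceil>b\<rceil> * k)"
      using g abc K by (intro mult_left_mono) auto
    also have "\<dots> \<le> real (nat \<lceil>K * a\<rceil>) * g (nat \<lceil>b\<rceil> * k)"
      by (intro mult_right_mono) linarith+
    finally show ?thesis by (simp flip: of_nat_mult)
  qed
  then show "\<exists>a b c. \<forall>k\<ge>c. f k \<le> a * g (b * k)" by blast
next
  assume "\<exists>a b c. \<forall>k\<ge>c. f k \<le> a * g (b * k)"
  then obtain a b c where abc: "\<And>k. k \<ge> c \<Longrightarrow> f k \<le> a * g (b * k)" by blast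
  \<comment> \<open>For \<open>r \<ge> 1\<close> the ceiling is at most \<open>2 * r\<close>, which
    explains the factor \<open>2 * b\<close>. The added ones keep both constants at least 1 even if
    \<open>a\<close> or \<open>b\<close> is 0, and \<open>Suc c\<close> ensures
    \<open>r \<ge> 1\<close>.\<close>
  have "u r \<le> (real a * K + 1) * v (real (2 * b + 1) * r)" if r: "r \<ge> real (Suc c)" for r
  proof -
    have r1: "r > 0" "r \<ge> 1" using r by auto
    let ?k = "nat \<lceil>r\<rceil>"
    have "real ?k \<le> 2 * r" using r1 by linarith
    then have "real b * real ?k \<le> real b * (2 * r)"
      by (intro mult_left_mono) auto
    then have "real (b * ?k) \<le> real (2 * b + 1) * r"
      using r1 by (simp add: algebra_simps)
    then have "b * ?k \<le> nat \<lceil>real (2 * b + 1) * r\<rceil>" by linarith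
    then have g: "g (b * ?k) \<le> g (nat \<lceil>real (2 * b + 1) * r\<rceil>)"
      using mono by (simp add: monoD)
    have pos: "real (2 * b + 1) * r > 0" using r1 by simp
    have v0: "v (real (2 * b + 1) * r) \<ge> 0"
      using v(2)[OF pos] K by (metis of_nat_0_le_iff order_trans zero_le_mult_iff not_le)
    have "?k \<ge> c" using r by linarith
    then have "real (f ?k) \<le> real (a * g (b * ?k))"
      using abc by (simp only: of_nat_le_iff)
    then have "u r \<le> real a * g (b * ?k)" using u(1)[OF r1(1)] by simp
    also have "\<dots> \<le> real a * g (nat \<lceil>real (2 * b + 1) * r\<rceil>)"
      using g by (intro mult_left_mono) auto
    also have "\<dots> \<le> real a * (K * v (real (2 * b + 1) * r))"
      using v(2)[OF pos] by (intro mult_left_mono) auto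
    also have "\<dots> \<le> (real a * K + 1) * v (real (2 * b + 1) * r)"
      using v0 by (simp add: algebra_simps)
    finally show ?thesis .
  qed
  then show "growth_dominated u v"
    unfolding growth_dominated_def using K
    by (intro exI[of _ "real a * K + 1"] exI[of _ "real (2 * b + 1)"] exI[of _ "real (Suc c)"] conjI allI impI)
      auto
qed

context regular_atlas
begin

text \<open>The index is the rounded-up radius, and a ball of that radius is reached in one step
  fewer; by truncated subtraction the values at 0 and 1 coincide.\<close>

definition label_growth :: "'a \<Rightarrow> nat \<Rightarrow> nat" where
  "label_growth x k = card (ball_labels U x (k - 1))"

lemma mono_label_growth: "x \<in> topspace X \<Longrightarrow> mono (label_growth x)"
  unfolding label_growth_def by (intro monoI card_mono finite_ball_labels ball_labels_mono) auto

lemma growth_dominated_leaf_growth_iff: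
  assumes "x \<in> topspace X" "y \<in> topspace X"
  shows "growth_dominated (leaf_growth n X A U x) (leaf_growth n X A U y) \<longleftrightarrow>
    (\<exists>a b c. \<forall>k\<ge>c. label_growth x k \<le> a * label_growth y (b * k))"
\<comment> \<open>The added 1 makes the positivity of the factor immediate.\<close>
proof (rule growth_dominated_iff_nat[where K = "real (card charts + 1)"])
  fix r :: real assume r: "r > 0"
  have *: "leaf_growth n X A U z r \<le> label_growth z (nat \<lceil>r\<rceil>) \<and>
      label_growth z (nat \<lceil>r\<rceil>) \<le> real (card charts + 1) * leaf_growth n X A U z r"
    if z: "z \<in> topspace X" for z
  proof -
    let ?L = "ball_labels U z (nat \<lceil>r\<rceil> - 1)"
    have "card ?L \<le> (card charts + 1) * card (label_plaque ` ?L)"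
      using card_ball_labels_le[of z "nat \<lceil>r\<rceil> - 1"] by (simp add: trans_le_add2)
    then have "real (card ?L) \<le> real ((card charts + 1) * card (label_plaque ` ?L))"
      by (simp only: of_nat_le_iff)
    then show ?thesis
      using card_image_le[OF finite_ball_labels, of label_plaque z "nat \<lceil>r\<rceil> - 1"]
      by (simp add: leaf_growth_eq[OF z r] label_growth_def distrib_right)
  qed
  show "leaf_growth n X A U x r \<le> label_growth x (nat \<lceil>r\<rceil>)"
    "label_growth x (nat \<lceil>r\<rceil>) \<le> real (card charts + 1) * leaf_growth n X A U x r"
    "leaf_growth n X A U y r \<le> label_growth y (nat \<lceil>r\<rceil>)"
    "label_growth y (nat \<lceil>r\<rceil>) \<le> real (card charts + 1) * leaf_growth n X A U y r"
    using * assms by blast+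
qed (use assms mono_label_growth in auto)

lemma borel_growth_relation: "borel_subset (prod_topology X X) (growth_relation n X A U)"
proof -
  define M where "M = sigma (topspace (prod_topology X X)) {V. openin (prod_topology X X) V}"
  have space_M: "space M = topspace X \<times> topspace X"
    unfolding M_def space_sigma_openin by simp
  have open_M: "V \<in> sets M" if "openin (prod_topology X X) V" for V
    using that borel_subset_measure[of "prod_topology X X" V]
    unfolding M_def borel_subset_def by (simp add: sigma_sets.Basic)
  have ge: "Measurable.pred M (\<lambda>p. m \<le> label_growth (\<pi> p) k)"
    if \<pi>: "continuous_map (prod_topology X X) X \<pi>" for \<pi> m k
  proof -
    have "openin (prod_topology X X) {p \<in> topspace (prod_topology X X).
        \<pi> p \<in> {x \<in> topspace X. m \<le> card (ball_labels U x (k - 1))}}"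
      by (rule openin_continuous_map_preimage[OF \<pi> openin_card_ball_labels_ge])
    moreover have "\<dots> = {p \<in> space M. m \<le> label_growth (\<pi> p) k}"
      using continuous_map_image_subset_topspace[OF \<pi>] by (auto simp: label_growth_def space_M)
    ultimately show ?thesis using open_M by (simp add: pred_def)
  qed
  define D where "D x y \<longleftrightarrow> (\<exists>a b c. \<forall>k\<ge>c. label_growth x k \<le> a * label_growth y (b * k))" for x y
  have pred_D: "Measurable.pred M (\<lambda>p. D (\<pi> p) (\<rho> p))"
    if \<pi>: "continuous_map (prod_topology X X) X \<pi>" and \<rho>: "continuous_map (prod_topology X X) X \<rho>"
    for \<pi> \<rho>
  proof -
    \<comment> \<open>An inequality between counts at two points is split into conditions
      \<open>m \<le> i\<close> and \<open>l \<le> j\<close>, each involving one point only and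
      defining an open set by semicontinuity. All quantifiers range over the natural numbers, so
      countable operations suffice.\<close>
    have le: "i \<le> a * j \<longleftrightarrow> (\<forall>m. m \<le> i \<longrightarrow> (\<exists>l. l \<le> j \<and> m \<le> a * l))" for i j a :: nat
      by (meson le_trans mult_le_mono2 order_refl)
    have "D (\<pi> p) (\<rho> p) \<longleftrightarrow> (\<exists>a b c. \<forall>k. k \<ge> c \<longrightarrow>
        (\<forall>m. m \<le> label_growth (\<pi> p) k \<longrightarrow> (\<exists>l. l \<le> label_growth (\<rho> p) (b * k) \<and> m \<le> a * l)))" for p
      unfolding D_def by (intro ex_cong1 all_cong1 imp_cong refl le)
    then show ?thesis
      by (simp only:) (intro pred_intros_countable pred_intros_logic ge \<pi> \<rho>; simp)
  qed
  have "growth_relation n X A U = {p \<in> space M. D (fst p) (snd p) \<and> D (snd p) (fst p)}"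
    by (auto simp: growth_relation_def same_growth_type_def space_M
        growth_dominated_leaf_growth_iff[folded D_def])
  also have "\<dots> \<in> sets M"
    using pred_D[OF continuous_map_fst continuous_map_snd] pred_D[OF continuous_map_snd continuous_map_fst]
    by (simp add: pred_def sets.sets_Collect_conj)
  finally show ?thesis by (simp add: borel_subset_measure M_def)
qed

end

theorem theorem1p5:
  fixes n :: nat
    and X :: "'a topology"
    and A U :: "('a, 'z) fchart set"
    and X0 :: "'a set"
    and R :: "('a \<times> 'a) set"
  assumes "compact_polish_foliated_space n X A"
    and "regular_foliated_atlas n X A U"
  defines "X0 \<equiv> leaves_without_holonomy_union n X A U"
    and "R \<equiv> growth_relation n X A U"
  shows "borel_subset (prod_topology (subtopology X X0) (subtopology X X0)) (R \<inter> X0 \<times> X0) \<and>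
         baire_subset (prod_topology X X) R \<and>
         (\<forall>C \<in> X0 // (R \<inter> X0 \<times> X0). borel_subset (subtopology X X0) C) \<and>
         (\<forall>C \<in> topspace X // R. baire_subset X C)"
proof -
  interpret regular_atlas n X A U
    using assms(1,2) by unfold_locales
  let ?Y = "subtopology X X0"
  have R: "borel_subset (prod_topology X X) R"
    unfolding R_def by (rule borel_growth_relation)
  \<comment> \<open>Borel sets of \<open>X \<times> X\<close> are pulled back along the continuous
    inclusion of the product of the subspaces.\<close>
  have "continuous_map (prod_topology ?Y ?Y) (prod_topology X X) id"
    by (simp add: continuous_map_from_subtopology flip: subtopology_Times)
  from borel_subset_continuous_preimage[OF this R]
  have "borel_subset (prod_topology ?Y ?Y) {p \<in> topspace (prod_topology ?Y ?Y). id p \<in> R}" .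
  moreover have "{p \<in> topspace (prod_topology ?Y ?Y). id p \<in> R} = R \<inter> X0 \<times> X0"
    by (auto simp: R_def growth_relation_def)
  ultimately have R0: "borel_subset (prod_topology ?Y ?Y) (R \<inter> X0 \<times> X0)"
    by simp
  then show ?thesis
    using R borel_imp_baire_subset[OF R] borel_subset_section[OF R0]
      borel_imp_baire_subset[OF borel_subset_section[OF R]]
    by (auto simp: quotient_def)
qed

end
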